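(* Suppose there exists $\hat R>0$ such that $$\lambda\left(\int_0^{+\infty} e^{\hat R y}\,dF_1(y)\cdot\int_0^{+\infty} e^{-\hat R y}\,dF_2(y)-1\right)=c\hat R .$$ Then for all $x\ge 0$, $$\psi(x)\le e^{-\hat R x}.$$
   Context: Let $(\Omega,\mathfrak F,\mathbb P)$ be a complete probability space on which all objects are defined. Let $c>0$ and $\lambda>0$ be constants. Let $(\xi_i)_{i\ge1}$ (claim sizes) be nonnegative i.i.d. random variables with c.d.f. $F_1(y)=\mathbb P[\xi_i\le y]$ and finite mean $\mu_1$. Let $(\eta_i)_{i\ge1}$ (additional funds) be nonnegative i.i.d. random variables with c.d.f. $F_2(y)=\mathbb P[\eta_i\le y]$ and finite mean $\mu_2$. Let $(N_t)_{t\ge0}$ be a homogeneous Poisson process with intensity $\lambda$. The sequences $(\xi_i)_{i\ge1}$, $(\eta_i)_{i\ge1}$ and the process $(N_t)_{t\ge0}$ are mutually independent. Assume that $\mathbb P[\xi_i-\eta_i>0]>0$ and $\mathbb P[\xi_i-\eta_i<0]>0$. For an initial surplus $x\ge0$, the surplus process is $$X_t(x)=x+ct-\sum_{i=1}^{N_t}(\xi_i-\eta_i),\quad t\ge0,$$ where the sum is $0$ if $N_t=0$. The ruin time is $\tau(x)=\inf\{t\ge0: X_t(x)<0\}$, with $\tau(x)=\infty$ if $X_t(x)\ge0$ for all $t\ge0$. The infinite-horizon ruin probability is $\psi(x)=\mathbb P[\tau(x)<\infty]=\mathbb P[\inf_{t\ge0}X_t(x)<0]$. Integrals with respect to $dF_1$,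 $dF_2$ over $[0,+\infty)$ are expectations: $\int_0^{+\infty} e^{Ry}\,dF_1(y)=\mathbb E[e^{R\xi_i}]$ and $\int_0^{+\infty} e^{-Ry}\,dF_2(y)=\mathbb E[e^{-R\eta_i}]$ (any atom at $0$ is included). The displayed equation in the hypothesis in particular requires $\mathbb E[e^{\hat R\xi_i}]<\infty$. *)

theory Defs
  imports "HOL-Probability.Probability"
begin

text \<open>
  The path properties are required almost surely. They make the truncated subtraction on
  \<^typ>\<open>nat\<close> in the increments harmless, since \<open>N s \<omega> \<le> N t \<omega>\<close> holds almost surely for \<open>s \<le> t\<close>.
\<close>

locale poisson_process = prob_space M
  for M :: "'a measure" +
  fixes rate :: real and N :: "real \<Rightarrow> 'a \<Rightarrow> nat"
  assumes rate_pos: "0 < rate"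
    and N_measurable: "\<And>t. 0 \<le> t \<Longrightarrow> random_variable (count_space UNIV) (N t)"
    and N_zero: "AE \<omega> in M. N 0 \<omega> = 0"
    and N_mono: "AE \<omega> in M. mono_on {0..} (\<lambda>t. N t \<omega>)"
    and N_right_continuous: "AE \<omega> in M. \<forall>t\<ge>0. continuous (at_right t) (\<lambda>s. N s \<omega>)"
    and N_increments: "\<And>s t. 0 \<le> s \<Longrightarrow> s < t \<Longrightarrow>
      distr M (count_space UNIV) (\<lambda>\<omega>. N t \<omega> - N s \<omega>) = measure_pmf (poisson_pmf (rate * (t - s)))"
    and N_indep_increments: "\<And>n ts. 0 \<le> ts 0 \<Longrightarrow> strict_mono_on {..n} ts \<Longrightarrow>
      indep_vars (\<lambda>_. count_space UNIV) (\<lambda>i \<omega>. N (ts (Suc i)) \<omega> - N (ts i) \<omega>) {..<n}"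

definition generated_events :: "'a measure \<Rightarrow> 'b measure \<Rightarrow> ('i \<Rightarrow> 'a \<Rightarrow> 'b) \<Rightarrow> 'i set \<Rightarrow> 'a set set"
  where "generated_events M K X I =
    sigma_sets (space M) (\<Union>i\<in>I. {X i -` A \<inter> space M | A. A \<in> sets K})"

locale risk_model = poisson_process M rate N + complete_measure M
  for M :: "'a measure" and rate :: real and N :: "real \<Rightarrow> 'a \<Rightarrow> nat" +
  fixes c :: real
    and \<xi> :: "nat \<Rightarrow> 'a \<Rightarrow> real" and F1 :: "real \<Rightarrow> real" and \<mu>1 :: real
    and \<eta> :: "nat \<Rightarrow> 'a \<Rightarrow> real" and F2 :: "real \<Rightarrow> real" and \<mu>2 :: real
  assumes c_pos: "0 < c"
    and \<xi>_nonneg: "\<And>i. 1 \<le> i \<Longrightarrow> AE \<omega> in M. 0 \<le> \<xi> i \<omega>"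
    and \<xi>_indep: "indep_vars (\<lambda>_. borel) \<xi> {1..}"
    and \<xi>_cdf: "\<And>i y. 1 \<le> i \<Longrightarrow> prob {\<omega> \<in> space M. \<xi> i \<omega> \<le> y} = F1 y"
    and \<xi>_mean: "\<And>i. 1 \<le> i \<Longrightarrow> integrable M (\<xi> i) \<and> expectation (\<xi> i) = \<mu>1"
    and \<eta>_nonneg: "\<And>i. 1 \<le> i \<Longrightarrow> AE \<omega> in M. 0 \<le> \<eta> i \<omega>"
    and \<eta>_indep: "indep_vars (\<lambda>_. borel) \<eta> {1..}"
    and \<eta>_cdf: "\<And>i y. 1 \<le> i \<Longrightarrow> prob {\<omega> \<in> space M. \<eta> i \<omega> \<le> y} = F2 y"
    and \<eta>_mean: "\<And>i. 1 \<le> i \<Longrightarrow> integrable M (\<eta> i) \<and> expectation (\<eta> i) = \<mu>2"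
    and mutually_independent: "indep_sets
      ((!) [generated_events M borel \<xi> {1..},
            generated_events M borel \<eta> {1..},
            generated_events M (count_space UNIV) N {0..}]) {..<3}"
    and loss_possible: "\<And>i. 1 \<le> i \<Longrightarrow> 0 < prob {\<omega> \<in> space M. \<xi> i \<omega> - \<eta> i \<omega> > 0}"
    and gain_possible: "\<And>i. 1 \<le> i \<Longrightarrow> 0 < prob {\<omega> \<in> space M. \<xi> i \<omega> - \<eta> i \<omega> < 0}"

definition surplus :: "real \<Rightarrow> (nat \<Rightarrow> 'a \<Rightarrow> real) \<Rightarrow> (nat \<Rightarrow> 'a \<Rightarrow> real) \<Rightarrow>
    (real \<Rightarrow> 'a \<Rightarrow> nat) \<Rightarrow> real \<Rightarrow> real \<Rightarrow> 'a \<Rightarrow> real"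
  where "surplus c \<xi> \<eta> N x t \<omega> = x + c * t - (\<Sum>i = 1..N t \<omega>. \<xi> i \<omega> - \<eta> i \<omega>)"

definition ruin_time :: "real \<Rightarrow> (nat \<Rightarrow> 'a \<Rightarrow> real) \<Rightarrow> (nat \<Rightarrow> 'a \<Rightarrow> real) \<Rightarrow>
    (real \<Rightarrow> 'a \<Rightarrow> nat) \<Rightarrow> real \<Rightarrow> 'a \<Rightarrow> ereal"
  where "ruin_time c \<xi> \<eta> N x \<omega> = (INF t \<in> {t. 0 \<le> t \<and> surplus c \<xi> \<eta> N x t \<omega> < 0}. ereal t)"

definition ruin_probability :: "'a measure \<Rightarrow> real \<Rightarrow> (nat \<Rightarrow> 'a \<Rightarrow> real) \<Rightarrow>
    (nat \<Rightarrow> 'a \<Rightarrow> real) \<Rightarrow> (real \<Rightarrow> 'a \<Rightarrow> nat) \<Rightarrow> real \<Rightarrow> real"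
  where "ruin_probability M c \<xi> \<eta> N x = measure M {\<omega> \<in> space M. ruin_time c \<xi> \<eta> N x \<omega> < \<infinity>}"

lemma ruin_time_finite_iff:
  "ruin_time c \<xi> \<eta> N x \<omega> < \<infinity> \<longleftrightarrow> (\<exists>t\<ge>0. surplus c \<xi> \<eta> N x t \<omega> < 0)"
  unfolding ruin_time_def INF_less_iff by auto

text \<open>
  \<^const>\<open>measure\<close> is \<open>0\<close> outside the \<open>\<sigma>\<close>-algebra, so the definition of the ruin probability
  is meaningful only because the ruin event is measurable; this uses completeness of the space.
\<close>

lemma (in risk_model) ruin_event_measurable:
  "{\<omega> \<in> space M. ruin_time c \<xi> \<eta> N x \<omega> < \<infinity>} \<in> events"
proof -
  let ?X = "surplus c \<xi> \<eta> N x"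
  define E where "E = {\<omega> \<in> space M. \<exists>t\<ge>0. ?X t \<omega> < 0}"
  define Q where "Q = (\<Union>q\<in>\<rat> \<inter> {0..}. {\<omega> \<in> space M. ?X q \<omega> < 0})"
  have [measurable]: "\<xi> i \<in> borel_measurable M" "\<eta> i \<in> borel_measurable M" if "1 \<le> i" for i
    using \<xi>_indep \<eta>_indep that by (auto simp: indep_vars_def)
  have X_measurable: "?X t \<in> borel_measurable M" if "0 \<le> t" for t
  proof -
    have "(\<lambda>\<omega>. \<Sum>i = 1..N t \<omega>. \<xi> i \<omega> - \<eta> i \<omega>) \<in> borel_measurable M"
      by (rule measurable_compose_countable[OF _ N_measurable[OF that]])
        (auto intro!: borel_measurable_sum borel_measurable_diff)
    then show ?thesis
      unfolding surplus_def[abs_def] by measurable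
  qed
  have "countable (\<rat> \<inter> {0::real..})"
    by (simp add: countable_rat countable_Int1)
  moreover have "{\<omega> \<in> space M. ?X q \<omega> < 0} \<in> events" if "0 \<le> q" for q
    using X_measurable[OF that] by measurable
  ultimately have Q: "Q \<in> events"
    unfolding Q_def by (intro sets.countable_UN'') auto
  obtain Z where Z: "Z \<in> null_sets M"
    and rc: "\<And>\<omega> t. \<omega> \<in> space M - Z \<Longrightarrow> 0 \<le> t \<Longrightarrow> continuous (at_right t) (\<lambda>s. N s \<omega>)"
    using N_right_continuous unfolding eventually_ae_filter by blast
  have "\<omega> \<in> Q" if "\<omega> \<in> E" "\<omega> \<notin> Z" for \<omega>
  proof -
    obtain t where t: "0 \<le> t" "?X t \<omega> < 0" and \<omega>: "\<omega> \<in> space M"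
      using \<open>\<omega> \<in> E\<close> by (auto simp: E_def)
    have "((\<lambda>s. N s \<omega>) \<longlongrightarrow> N t \<omega>) (at_right t)"
      using rc[of \<omega> t] \<omega> that(2) t by (auto simp: continuous_within)
    then have 1: "\<forall>\<^sub>F s in at_right t. N s \<omega> = N t \<omega>"
      by (simp add: tendsto_discrete)
    let ?S = "\<Sum>i = 1..N t \<omega>. \<xi> i \<omega> - \<eta> i \<omega>"
    have "((\<lambda>s. x + c * s - ?S) \<longlongrightarrow> x + c * t - ?S) (at_right t)"
      by (intro tendsto_intros)
    then have 2: "\<forall>\<^sub>F s in at_right t. x + c * s - ?S < 0"
      using t by (intro order_tendstoD(2)) (auto simp: surplus_def)
    from 1 2 have "\<forall>\<^sub>F s in at_right t. ?X s \<omega> < 0"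
      by eventually_elim (simp add: surplus_def)
    then obtain b where b: "t < b" "\<And>s. t < s \<Longrightarrow> s < b \<Longrightarrow> ?X s \<omega> < 0"
      by (auto simp: eventually_at_right[OF less_add_one])
    obtain q where "q \<in> \<rat>" "t < q" "q < b"
      using Rats_dense_in_real[OF b(1)] by auto
    then show ?thesis
      using b(2) t \<omega> by (auto simp: Q_def intro!: bexI[of _ q])
  qed
  moreover have "Q \<subseteq> E"
    by (auto simp: Q_def E_def)
  ultimately have "E = Q \<union> E \<inter> Z"
    by auto
  moreover have "E \<inter> Z \<in> events"
    by (rule complete[OF _ Z]) auto
  ultimately have "E \<in> events"
    using Q by (metis sets.Un)
  then show ?thesis
    unfolding E_def ruin_time_finite_iff .
qed

end

theory Submission
  imports Defs
begin

text \<open>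
  Along a grid of times \<open>k h\<close> the surplus is a random walk with independent steps \<open>U\<close>. A step consists of
  the premium \<open>c h\<close> and a Poisson number of net claims, so the adjustment equation says exactly
  \<open>E [exp (- R U)] = 1\<close>, and \<open>exp (- R X)\<close> is a martingale along the grid. Doob's maximal inequality
  bounds the probability of ruin on the grid by \<open>exp (- R x)\<close>. By right-continuity, ruin is almost surely
  already visible on some dyadic grid, and the bound passes to the limit.
\<close>

section \<open>Splitting integrals by a count, and combining independent families\<close>

text \<open>This replaces conditioning on a random count: on each piece the count is fixed, so a
  product of randomly many factors becomes one of fixed length.\<close>

lemma nn_integral_partition_nat:
  fixes V :: "'a \<Rightarrow> nat"
  assumes [measurable]: "V \<in> measurable M (count_space UNIV)" "f \<in> borel_measurable M"
  shows "(\<integral>\<^sup>+\<omega>. f \<omega> \<partial>M) = (\<Sum>v. \<integral>\<^sup>+\<omega>. f \<omega> * of_bool (V \<omega> = v) \<partial>M)"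
proof -
  have "(\<Sum>v. f \<omega> * of_bool (V \<omega> = v)) = f \<omega>" for \<omega>
    by (subst suminf_finite[of "{V \<omega>}"]) auto
  then have "(\<integral>\<^sup>+\<omega>. f \<omega> \<partial>M) = (\<integral>\<^sup>+\<omega>. (\<Sum>v. f \<omega> * of_bool (V \<omega> = v)) \<partial>M)"
    by simp
  also have "\<dots> = (\<Sum>v. \<integral>\<^sup>+\<omega>. f \<omega> * of_bool (V \<omega> = v) \<partial>M)"
    by (rule nn_integral_suminf) measurable
  finally show ?thesis .
qed

context prob_space
begin

text \<open>Functions of disjoint blocks of an independent family are independent, so their
  expectations multiply. With values in \<open>ennreal\<close> no integrability has to be
  checked.\<close>

lemma nn_integral_mult_indep_blocks:
  assumes indep: "indep_vars M' X I" and AB: "A \<inter> B = {}" "A \<subseteq> I" "B \<subseteq> I"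
    and f: "f \<in> borel_measurable (PiM A M')" and g: "g \<in> borel_measurable (PiM B M')"
  shows "(\<integral>\<^sup>+\<omega>. f (\<lambda>i\<in>A. X i \<omega>) * g (\<lambda>i\<in>B. X i \<omega>) \<partial>M) =
    (\<integral>\<^sup>+\<omega>. f (\<lambda>i\<in>A. X i \<omega>) \<partial>M) * (\<integral>\<^sup>+\<omega>. g (\<lambda>i\<in>B. X i \<omega>) \<partial>M)"
proof -
  let ?f = "\<lambda>\<omega>. f (\<lambda>i\<in>A. X i \<omega>)" and ?g = "\<lambda>\<omega>. g (\<lambda>i\<in>B. X i \<omega>)"
  have "indep_var borel ?f borel ?g"
    using indep_var_compose[OF indep_var_restrict[OF indep AB] f g] by (simp add: comp_def)
  \<comment> \<open>Unfolding \<open>indep_var\<close> leaves the target spaces as a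
    \<open>case_bool\<close>; both are \<open>borel\<close>, so the congruence rule turns them into
    a constant family.\<close>
  then have "indep_vars (\<lambda>_. borel) (case_bool ?f ?g) UNIV"
    unfolding indep_var_def by (rule indep_vars_cong[THEN iffD1, rotated -1]) (auto split: bool.split)
  from indep_vars_nn_integral[OF _ this] show ?thesis
    by (simp add: UNIV_bool mult.commute)
qed

text \<open>A finite intersection of events is grouped by the first index. Each group lies in the
  sigma-algebra of its family, so \<open>outer\<close> factors the groups apart, and
  \<open>inner\<close> then factors each group.\<close>

lemma indep_vars_Sigma:
  assumes rv: "\<And>k i. k \<in> K \<Longrightarrow> i \<in> I k \<Longrightarrow> random_variable S (X (k, i))"
    and inner: "\<And>k. k \<in> K \<Longrightarrow> indep_vars (\<lambda>_. S) (\<lambda>i. X (k, i)) (I k)"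
    and outer: "indep_sets
      (\<lambda>k. sigma_sets (space M) (\<Union>i\<in>I k. {X (k, i) -` A \<inter> space M | A. A \<in> sets S})) K"
  shows "indep_vars (\<lambda>_. S) X (Sigma K I)"
  unfolding indep_vars_def2
proof (intro conjI ballI indep_setsI)
  fix p assume "p \<in> Sigma K I" then show "random_variable S (X p)"
    using rv by auto
next
  fix p assume "p \<in> Sigma K I" then show "{X p -` A \<inter> space M |A. A \<in> sets S} \<subseteq> events"
    using rv by (auto intro!: measurable_sets)
next
  fix A J assume J: "J \<noteq> {}" "J \<subseteq> Sigma K I" "finite J"
    and A: "\<forall>p\<in>J. A p \<in> {X p -` A \<inter> space M |A. A \<in> sets S}"
  \<comment> \<open>\<open>?J k\<close> is the slice of \<open>J\<close> in family \<open>k\<close>;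
    \<open>J\<close> is the disjoint union of its slices.\<close>
  let ?J = "\<lambda>k. Pair k -` J"
  have fin: "finite (?J k)" for k
    using J(3) by (rule finite_vimageI) (auto simp: inj_on_def)
  have JS: "J = Sigma (fst ` J) ?J"
  proof (rule set_eqI)
    fix p show "p \<in> J \<longleftrightarrow> p \<in> Sigma (fst ` J) ?J"
      by (cases p) (auto intro: rev_image_eqI)
  qed
  have inter: "(\<Inter>p\<in>J. A p) = (\<Inter>k\<in>fst ` J. \<Inter>i\<in>?J k. A (k, i))"
  proof (rule set_eqI)
    fix \<omega> show "\<omega> \<in> (\<Inter>p\<in>J. A p) \<longleftrightarrow> \<omega> \<in> (\<Inter>k\<in>fst ` J. \<Inter>i\<in>?J k. A (k, i))"
      by (subst JS) (auto simp only: INT_iff Sigma_def UN_iff singleton_iff simp_thms ball_simps)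
  qed
  let ?G = "\<lambda>k. sigma_sets (space M) (\<Union>i\<in>I k. {X (k, i) -` A \<inter> space M | A. A \<in> sets S})"
  have slice: "(\<Inter>i\<in>?J k. A (k, i)) \<in> ?G k" if "k \<in> fst ` J" for k
  proof -
    interpret S: sigma_algebra "space M" "?G k"
      by (rule sigma_algebra_sigma_sets) auto
    have mem: "A (k, i) \<in> ?G k" if i: "i \<in> ?J k" for i
    proof (rule sigma_sets.Basic)
      have "(k, i) \<in> J" using i by simp
      moreover from this have "i \<in> I k" using J(2) by auto
      ultimately show "A (k, i) \<in> (\<Union>i\<in>I k. {X (k, i) -` A \<inter> space M | A. A \<in> sets S})"
        using bspec[OF A] by (intro UN_I)
    qed
    have "?J k \<noteq> {}" using that by auto
    from S.finite_INT[OF fin this mem] show ?thesis .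
  qed
  have "prob (\<Inter>k\<in>fst ` J. \<Inter>i\<in>?J k. A (k, i)) = (\<Prod>k\<in>fst ` J. prob (\<Inter>i\<in>?J k. A (k, i)))"
  proof (rule indep_setsD[OF outer])
    show "fst ` J \<subseteq> K" "fst ` J \<noteq> {}" "finite (fst ` J)"
      using J by auto
    show "\<forall>k\<in>fst ` J. (\<Inter>i\<in>?J k. A (k, i)) \<in> ?G k"
      using slice by blast
  qed
  also have "\<dots> = (\<Prod>k\<in>fst ` J. \<Prod>i\<in>?J k. prob (A (k, i)))"
  proof (rule prod.cong[OF refl])
    fix k assume k: "k \<in> fst ` J"
    then have "k \<in> K"
      using J(2) by (auto dest!: subsetD)
    from inner[OF this] have "indep_sets (\<lambda>i. {X (k, i) -` A \<inter> space M |A. A \<in> sets S}) (I k)"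
      by (simp add: indep_vars_def2)
    then show "prob (\<Inter>i\<in>?J k. A (k, i)) = (\<Prod>i\<in>?J k. prob (A (k, i)))"
    proof (rule indep_setsD)
      show "?J k \<subseteq> I k" "?J k \<noteq> {}" "finite (?J k)"
        using k J(2) fin by auto
      show "\<forall>i\<in>?J k. A (k, i) \<in> {X (k, i) -` A \<inter> space M |A. A \<in> sets S}"
        using A by blast
    qed
  qed
  also have "\<dots> = (\<Prod>p\<in>Sigma (fst ` J) ?J. prob (A p))"
    using J(3) fin by (subst prod.Sigma) auto
  finally show "prob (\<Inter>p\<in>J. A p) = (\<Prod>p\<in>J. prob (A p))"
    unfolding inter JS[symmetric] .
qed

end

section \<open>Maximal inequality for a random walk with compound steps\<close>

text \<open>\<open>D j\<close> counts the net claims \<open>Z\<close> arriving in step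
  \<open>j\<close>, \<open>a j\<close> is the premium of that step and \<open>x\<close> the initial
  surplus. \<open>D_exp\<close> is the adjustment equation in multiplicative form: compounding
  \<open>m\<close> over the claims of a step exactly offsets the premium. Counts are cast to reals
  so that claims and counts form one family with target \<open>borel\<close>.\<close>

locale compound_walk = prob_space M for M :: "'a measure" +
  fixes Z :: "nat \<Rightarrow> 'a \<Rightarrow> real" and D :: "nat \<Rightarrow> 'a \<Rightarrow> nat" and n :: nat
    and a :: "nat \<Rightarrow> real" and R m x :: real
  assumes D_measurable [measurable]: "\<And>j. D j \<in> measurable M (count_space UNIV)"
    and indep: "indep_vars (\<lambda>_. borel) (case_sum Z (\<lambda>j \<omega>. real (D j \<omega>))) (range Inl \<union> Inr ` {..<n})"
    and Z_exp: "\<And>i. (\<integral>\<^sup>+\<omega>. ennreal (exp (R * Z i \<omega>)) \<partial>M) = ennreal m"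
    and D_exp: "\<And>j. j < n \<Longrightarrow> (\<integral>\<^sup>+\<omega>. ennreal m ^ D j \<omega> \<partial>M) = ennreal (exp (R * a j))"
    and R_nonneg: "0 \<le> R"
begin

definition claims :: "nat \<Rightarrow> 'a \<Rightarrow> nat" where "claims k \<omega> = (\<Sum>j<k. D j \<omega>)"

definition walk :: "nat \<Rightarrow> 'a \<Rightarrow> real"
  where "walk k \<omega> = x + (\<Sum>j<k. a j) - (\<Sum>i<claims k \<omega>. Z i \<omega>)"

abbreviation "solvent k \<omega> \<equiv> \<forall>j\<le>k. 0 \<le> walk j \<omega>"

lemma Z_measurable [measurable]: "Z i \<in> borel_measurable M"
  using indep by (force simp: indep_vars_def)

lemma claims_measurable [measurable]: "claims k \<in> measurable M (count_space UNIV)"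
  unfolding claims_def[abs_def] by measurable

lemma walk_measurable [measurable]: "walk k \<in> borel_measurable M"
proof -
  have "(\<lambda>\<omega>. \<Sum>i<claims k \<omega>. Z i \<omega>) \<in> borel_measurable M"
    by (rule measurable_compose_countable[OF _ claims_measurable]) measurable
  then show ?thesis unfolding walk_def[abs_def] by measurable
qed

lemma claims_mono: "j \<le> k \<Longrightarrow> claims j \<omega> \<le> claims k \<omega>"
  unfolding claims_def by (rule sum_mono2) auto

text \<open>With both counts fixed, the step factors into a deterministic premium part and a product
  over a fixed range of claims, to which independence applies.\<close>

lemma exp_walk_Suc:
  assumes "claims k \<omega> = s" "D k \<omega> = d"
  shows "exp (- R * walk (Suc k) \<omega>) =
    exp (- R * walk k \<omega>) * exp (- R * a k) * (\<Prod>i=s..<s+d. exp (R * Z i \<omega>))"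
proof -
  have "claims (Suc k) \<omega> = s + d"
    using assms by (simp add: claims_def)
  moreover have "(\<Sum>i<s+d. Z i \<omega>) = (\<Sum>i<s. Z i \<omega>) + (\<Sum>i=s..<s+d. Z i \<omega>)"
    by (metis atLeast0LessThan le_add1 sum.atLeastLessThan_concat zero_le)
  ultimately have "walk (Suc k) \<omega> = walk k \<omega> + a k - (\<Sum>i=s..<s+d. Z i \<omega>)"
    using assms by (simp add: walk_def)
  then have "- R * walk (Suc k) \<omega> = - R * walk k \<omega> + - R * a k + (\<Sum>i=s..<s+d. R * Z i \<omega>)"
    by (simp add: right_diff_distrib distrib_left sum_distrib_left sum_negf)
  then show ?thesis
    by (simp only: exp_add exp_sum finite_atLeastLessThan)
qed

text \<open>With \<open>s\<close> past and \<open>d\<close> new claims fixed, the past is a function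
  of the coordinates in \<open>A\<close> and the new step of those in \<open>B\<close>. The blocks
  are disjoint, so the integral factors, and each of the \<open>d\<close> new claims contributes
  \<open>m\<close>.\<close>

lemma nn_integral_block:
  assumes k: "k < n"
  shows "(\<integral>\<^sup>+\<omega>. ennreal (exp (- R * walk (Suc k) \<omega>)) * of_bool (solvent k \<omega>)
        * of_bool (claims k \<omega> = s) * of_bool (D k \<omega> = d) \<partial>M) =
    (\<integral>\<^sup>+\<omega>. ennreal (exp (- R * walk k \<omega>)) * of_bool (solvent k \<omega>) * of_bool (claims k \<omega> = s) \<partial>M)
      * (ennreal (exp (- R * a k)) * (\<integral>\<^sup>+\<omega>. ennreal m ^ D k \<omega> * of_bool (D k \<omega> = d) \<partial>M))"
proof -
  define W where "W = case_sum Z (\<lambda>j \<omega>. real (D j \<omega>))"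
  define A :: "(nat + nat) set" where "A = Inl ` {..<s} \<union> Inr ` {..<k}"
  define B :: "(nat + nat) set" where "B = Inl ` {s..<s+d} \<union> {Inr k}"
  \<comment> \<open>On the event that exactly \<open>s\<close> claims occurred before step \<open>k\<close>, the past depends only on
    \<open>Z 0, \<dots>, Z (s - 1)\<close> and \<open>D 0, \<dots>, D (k - 1)\<close>.\<close>
  define h where "h w = x + (\<Sum>j<k. a j) - (\<Sum>i<s. w (Inl i))" for w :: "nat + nat \<Rightarrow> real"
  \<comment> \<open>The sum has the fixed range \<open>i < s\<close>, and the indicator keeps only
    the claims made before step \<open>j\<close>. Thus earlier values of the walk become functions
    of finitely many coordinates in \<open>A\<close>, although their number of claims is
    random.\<close>
  define u where "u j w = x + (\<Sum>l<j. a l) - (\<Sum>i<s. w (Inl i) * of_bool (real i < (\<Sum>l<j. w (Inr l))))"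
    for j :: nat and w :: "nat + nat \<Rightarrow> real"
  define f where "f w = ennreal (exp (- R * h w)) * of_bool (\<forall>j\<le>k. 0 \<le> u j w)
      * of_bool ((\<Sum>l<k. w (Inr l)) = real s)" for w
  define g where "g w = (\<Prod>i=s..<s+d. ennreal (exp (R * w (Inl i)))) * of_bool (w (Inr k) = real d)"
    for w :: "nat + nat \<Rightarrow> real"
  have [measurable]: "(\<lambda>w::nat + nat \<Rightarrow> real. w (Inl i)) \<in> borel_measurable (PiM A (\<lambda>_. borel))" if "i < s" for i
    using that by (intro measurable_component_singleton) (auto simp: A_def)
  have [measurable]: "(\<lambda>w::nat + nat \<Rightarrow> real. w (Inr j)) \<in> borel_measurable (PiM A (\<lambda>_. borel))" if "j < k" for j
    using that by (intro measurable_component_singleton) (auto simp: A_def)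
  have [measurable]: "(\<lambda>w::nat + nat \<Rightarrow> real. w (Inl i)) \<in> borel_measurable (PiM B (\<lambda>_. borel))" if "i \<in> {s..<s+d}" for i
    using that by (intro measurable_component_singleton) (auto simp: B_def)
  have [measurable]: "(\<lambda>w::nat + nat \<Rightarrow> real. w (Inr k)) \<in> borel_measurable (PiM B (\<lambda>_. borel))"
    by (intro measurable_component_singleton) (auto simp: B_def)
  have cl: "(\<lambda>w::nat + nat \<Rightarrow> real. \<Sum>l<j. w (Inr l)) \<in> borel_measurable (PiM A (\<lambda>_. borel))" if "j \<le> k" for j
    using that by (intro borel_measurable_sum measurable_component_singleton) (auto simp: A_def)
  have [measurable]: "u j \<in> borel_measurable (PiM A (\<lambda>_. borel))" if "j \<le> k" for j
    unfolding u_def[abs_def] using cl[OF that, measurable]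
    by measurable
  have "h \<in> borel_measurable (PiM A (\<lambda>_. borel))"
    unfolding h_def[abs_def] by measurable
  then have f: "f \<in> borel_measurable (PiM A (\<lambda>_. borel))"
    unfolding f_def[abs_def] using cl[OF order_refl, measurable] by measurable
  have g: "g \<in> borel_measurable (PiM B (\<lambda>_. borel))"
    unfolding g_def[abs_def] by measurable
  have claims_real: "(\<Sum>l<j. W (Inr l) \<omega>) = real (claims j \<omega>)" for j \<omega>
    by (simp add: W_def claims_def)
  have f_eq: "f (\<lambda>i\<in>A. W i \<omega>) =
      ennreal (exp (- R * walk k \<omega>)) * of_bool (solvent k \<omega>) * of_bool (claims k \<omega> = s)" for \<omega>
  proof -
    have cl': "(\<Sum>l<j. (\<lambda>i\<in>A. W i \<omega>) (Inr l)) = real (claims j \<omega>)" if "j \<le> k" for j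
      using that claims_real[of \<omega> j] by (auto simp: A_def intro!: sum.cong)
    \<comment> \<open>The identification is valid only for \<open>claims k \<omega> = s\<close>;
      elsewhere both sides of \<open>f_eq\<close> vanish through their last factor.\<close>
    have "h (\<lambda>i\<in>A. W i \<omega>) = walk k \<omega> \<and> (\<forall>j\<le>k. u j (\<lambda>i\<in>A. W i \<omega>) = walk j \<omega>)" if s: "claims k \<omega> = s"
    proof (intro conjI allI impI)
      show "h (\<lambda>i\<in>A. W i \<omega>) = walk k \<omega>"
        using s by (auto simp: h_def walk_def A_def W_def)
    next
      fix j assume j: "j \<le> k"
      have "(\<Sum>i<s. (\<lambda>i\<in>A. W i \<omega>) (Inl i) * of_bool (real i < real (claims j \<omega>))) =
          (\<Sum>i<s. if i < claims j \<omega> then Z i \<omega> else 0)"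
        by (rule sum.cong) (auto simp: A_def W_def)
      also have "\<dots> = (\<Sum>i<claims j \<omega>. Z i \<omega>)"
      proof -
        have "{..<s} \<inter> {i. i < claims j \<omega>} = {..<claims j \<omega>}"
          using claims_mono[OF j, of \<omega>] s by auto
        then show ?thesis by (simp add: sum.If_cases)
      qed
      finally show "u j (\<lambda>i\<in>A. W i \<omega>) = walk j \<omega>"
        by (simp only: u_def walk_def cl'[OF j])
    qed
    then show ?thesis
      unfolding f_def cl'[OF order_refl] by (cases "claims k \<omega> = s") auto
  qed
  have g_eq: "g (\<lambda>i\<in>B. W i \<omega>) = (\<Prod>i=s..<s+d. ennreal (exp (R * Z i \<omega>))) * of_bool (D k \<omega> = d)" for \<omega>
    unfolding g_def by (intro arg_cong2[where f="(*)"] prod.cong) (auto simp: B_def W_def indicator_def)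
  have D_meas: "(\<lambda>\<omega>. of_bool (D k \<omega> = d) :: ennreal) \<in> borel_measurable M"
    by measurable
  have g_int: "(\<integral>\<^sup>+\<omega>. g (\<lambda>i\<in>B. W i \<omega>) \<partial>M) = (\<integral>\<^sup>+\<omega>. ennreal m ^ D k \<omega> * of_bool (D k \<omega> = d) \<partial>M)"
  proof -
    \<comment> \<open>Independence is used a second time, now inside \<open>B\<close>: each claim
      factor has expectation \<open>m\<close>, and the count contributes the probability of
      \<open>D k = d\<close>.\<close>
    define G :: "nat + nat \<Rightarrow> real \<Rightarrow> ennreal" where "G = case_sum (\<lambda>_ y. ennreal (exp (R * y))) (\<lambda>_ y. of_bool (y = real d))"
    have "indep_vars (\<lambda>_. borel) W B"
      unfolding W_def using k by (rule_tac indep_vars_subset[OF indep]) (auto simp: B_def)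
    then have "indep_vars (\<lambda>_. borel) (\<lambda>b \<omega>. G b (W b \<omega>)) B"
      by (rule indep_vars_compose2) (auto simp: G_def split: sum.split)
    from indep_vars_nn_integral[OF _ this]
    have "(\<integral>\<^sup>+\<omega>. (\<Prod>b\<in>B. G b (W b \<omega>)) \<partial>M) = (\<Prod>b\<in>B. \<integral>\<^sup>+\<omega>. G b (W b \<omega>) \<partial>M)"
      by (simp add: B_def)
    moreover have B_prod: "(\<Prod>b\<in>B. q b) = (\<Prod>i=s..<s+d. q (Inl i)) * q (Inr k)" for q :: "_ \<Rightarrow> ennreal"
      unfolding B_def by (subst prod.union_disjoint) (auto simp: prod.reindex)
    ultimately have "(\<integral>\<^sup>+\<omega>. (\<Prod>i=s..<s+d. ennreal (exp (R * Z i \<omega>))) * of_bool (D k \<omega> = d) \<partial>M) =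
        ennreal m ^ d * (\<integral>\<^sup>+\<omega>. of_bool (D k \<omega> = d) \<partial>M)"
      by (simp add: G_def W_def Z_exp indicator_def)
    also have "\<dots> = (\<integral>\<^sup>+\<omega>. ennreal m ^ d * of_bool (D k \<omega> = d) \<partial>M)"
      by (rule nn_integral_cmult[symmetric]) (rule D_meas)
    \<comment> \<open>Writing the exponent as \<open>D k \<omega>\<close> lets the later sum over
      \<open>d\<close> reassemble the generating function in \<open>D_exp\<close>.\<close>
    also have "\<dots> = (\<integral>\<^sup>+\<omega>. ennreal m ^ D k \<omega> * of_bool (D k \<omega> = d) \<partial>M)"
      by (rule nn_integral_cong) (auto simp: indicator_def)
    finally show ?thesis by (simp add: g_eq)
  qed
  have "(\<integral>\<^sup>+\<omega>. ennreal (exp (- R * walk (Suc k) \<omega>)) * of_bool (solvent k \<omega>)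
        * of_bool (claims k \<omega> = s) * of_bool (D k \<omega> = d) \<partial>M) =
      (\<integral>\<^sup>+\<omega>. ennreal (exp (- R * a k)) * (f (\<lambda>i\<in>A. W i \<omega>) * g (\<lambda>i\<in>B. W i \<omega>)) \<partial>M)"
  proof (rule nn_integral_cong)
    fix \<omega>
    show "ennreal (exp (- R * walk (Suc k) \<omega>)) * of_bool (solvent k \<omega>)
        * of_bool (claims k \<omega> = s) * of_bool (D k \<omega> = d) =
        ennreal (exp (- R * a k)) * (f (\<lambda>i\<in>A. W i \<omega>) * g (\<lambda>i\<in>B. W i \<omega>))"
    proof (cases "claims k \<omega> = s \<and> D k \<omega> = d")
      case True
      then show ?thesis
        unfolding f_eq g_eq using exp_walk_Suc[of k \<omega> s d]
        by (simp add: ennreal_mult prod_ennreal prod_nonneg mult_ac)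
    qed (auto simp: f_eq g_eq)
  qed
  also have "\<dots> = ennreal (exp (- R * a k)) * (\<integral>\<^sup>+\<omega>. f (\<lambda>i\<in>A. W i \<omega>) * g (\<lambda>i\<in>B. W i \<omega>) \<partial>M)"
    by (rule nn_integral_cmult) (simp only: f_eq g_eq, measurable)
  also have "(\<integral>\<^sup>+\<omega>. f (\<lambda>i\<in>A. W i \<omega>) * g (\<lambda>i\<in>B. W i \<omega>) \<partial>M) =
      (\<integral>\<^sup>+\<omega>. f (\<lambda>i\<in>A. W i \<omega>) \<partial>M) * (\<integral>\<^sup>+\<omega>. g (\<lambda>i\<in>B. W i \<omega>) \<partial>M)"
    by (rule nn_integral_mult_indep_blocks[OF indep[folded W_def] _ _ _ f g])
      (use k in \<open>auto simp: A_def B_def\<close>)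
  finally show ?thesis
    unfolding g_int by (simp only: f_eq mult_ac)
qed

text \<open>This is the martingale property, tested on the past event of solvency up to step
  \<open>k\<close>. Summing the blocks over \<open>d\<close> gives \<open>exp (R * a k)\<close> by
  \<open>D_exp\<close>, which cancels the premium factor; summing over \<open>s\<close> restores the
  integral.\<close>

lemma nn_integral_step:
  assumes k: "k < n"
  shows "(\<integral>\<^sup>+\<omega>. ennreal (exp (- R * walk (Suc k) \<omega>)) * of_bool (solvent k \<omega>) \<partial>M) =
    (\<integral>\<^sup>+\<omega>. ennreal (exp (- R * walk k \<omega>)) * of_bool (solvent k \<omega>) \<partial>M)" (is "?l = ?r")
proof -
  let ?Y = "\<lambda>\<omega>. ennreal (exp (- R * walk k \<omega>)) * of_bool (solvent k \<omega>)"
  let ?Y' = "\<lambda>\<omega>. ennreal (exp (- R * walk (Suc k) \<omega>)) * of_bool (solvent k \<omega>)"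
  have "?l = (\<Sum>s. \<integral>\<^sup>+\<omega>. ?Y' \<omega> * of_bool (claims k \<omega> = s) \<partial>M)"
    by (rule nn_integral_partition_nat) measurable
  also have "\<dots> = (\<Sum>s. \<Sum>d. \<integral>\<^sup>+\<omega>. ?Y' \<omega> * of_bool (claims k \<omega> = s) * of_bool (D k \<omega> = d) \<partial>M)"
    by (intro arg_cong[where f=suminf] ext nn_integral_partition_nat) measurable
  also have "\<dots> = (\<Sum>s. (\<integral>\<^sup>+\<omega>. ?Y \<omega> * of_bool (claims k \<omega> = s) \<partial>M) * (ennreal (exp (- R * a k)) *
      (\<Sum>d. \<integral>\<^sup>+\<omega>. ennreal m ^ D k \<omega> * of_bool (D k \<omega> = d) \<partial>M)))"
    unfolding nn_integral_block[OF k] ennreal_suminf_cmult ..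
  also have "(\<Sum>d. \<integral>\<^sup>+\<omega>. ennreal m ^ D k \<omega> * of_bool (D k \<omega> = d) \<partial>M) = ennreal (exp (R * a k))"
    unfolding D_exp[OF k, symmetric] by (rule nn_integral_partition_nat[symmetric]) measurable
  also have "ennreal (exp (- R * a k)) * ennreal (exp (R * a k)) = 1"
    by (simp add: ennreal_mult[symmetric] exp_add[symmetric])
  also have "(\<Sum>s. (\<integral>\<^sup>+\<omega>. ?Y \<omega> * of_bool (claims k \<omega> = s) \<partial>M) * 1) = ?r"
    unfolding mult_1_right by (rule nn_integral_partition_nat[symmetric]) measurable
  finally show ?thesis .
qed

text \<open>The integrand is \<open>exp (- R * walk)\<close> stopped at ruin, with the stopped value lowered to \<open>1\<close>.\<close>

lemma nn_integral_stopped_le: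
  assumes "0 \<le> x" "k \<le> n"
  shows "(\<integral>\<^sup>+\<omega>. of_bool (\<not> solvent k \<omega>) + ennreal (exp (- R * walk k \<omega>)) * of_bool (solvent k \<omega>) \<partial>M)
    \<le> ennreal (exp (- R * x))"
  using assms(2)
proof (induction k)
  case 0
  \<comment> \<open>Since \<open>0 \<le> x\<close>, the walk starts solvent and the integrand is the
    constant \<open>exp (- R * x)\<close>.\<close>
  then show ?case using assms(1) by (simp add: walk_def claims_def emeasure_space_1)
next
  case (Suc k)
  have "(\<integral>\<^sup>+\<omega>. of_bool (\<not> solvent (Suc k) \<omega>) + ennreal (exp (- R * walk (Suc k) \<omega>)) * of_bool (solvent (Suc k) \<omega>) \<partial>M)
    \<le> (\<integral>\<^sup>+\<omega>. of_bool (\<not> solvent k \<omega>) + ennreal (exp (- R * walk (Suc k) \<omega>)) * of_bool (solvent k \<omega>) \<partial>M)"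
  proof (rule nn_integral_mono)
    fix \<omega>
    have all_Suc: "solvent (Suc k) \<omega> \<longleftrightarrow> solvent k \<omega> \<and> 0 \<le> walk (Suc k) \<omega>"
      by (auto simp: le_Suc_eq)
    \<comment> \<open>When ruin occurs first at step \<open>Suc k\<close>, the exponential is at
      least \<open>1\<close>, so replacing it by \<open>1\<close> only lowers the integral.\<close>
    have "1 \<le> ennreal (exp (- R * walk (Suc k) \<omega>))" if "walk (Suc k) \<omega> < 0"
      using that R_nonneg by (simp add: mult_nonneg_nonpos)
    then show "of_bool (\<not> solvent (Suc k) \<omega>) + ennreal (exp (- R * walk (Suc k) \<omega>)) * of_bool (solvent (Suc k) \<omega>)
      \<le> of_bool (\<not> solvent k \<omega>) + ennreal (exp (- R * walk (Suc k) \<omega>)) * of_bool (solvent k \<omega>)"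
      by (cases "solvent k \<omega>") (auto simp: all_Suc not_le)
  qed
  also have "\<dots> = (\<integral>\<^sup>+\<omega>. of_bool (\<not> solvent k \<omega>) \<partial>M)
      + (\<integral>\<^sup>+\<omega>. ennreal (exp (- R * walk (Suc k) \<omega>)) * of_bool (solvent k \<omega>) \<partial>M)"
    by (rule nn_integral_add) measurable
  also have "\<dots> = (\<integral>\<^sup>+\<omega>. of_bool (\<not> solvent k \<omega>) \<partial>M)
      + (\<integral>\<^sup>+\<omega>. ennreal (exp (- R * walk k \<omega>)) * of_bool (solvent k \<omega>) \<partial>M)"
    using Suc.prems by (simp only: nn_integral_step[of k])
  also have "\<dots> = (\<integral>\<^sup>+\<omega>. of_bool (\<not> solvent k \<omega>) + ennreal (exp (- R * walk k \<omega>)) * of_bool (solvent k \<omega>) \<partial>M)"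
    by (rule nn_integral_add[symmetric]) measurable
  also have "\<dots> \<le> ennreal (exp (- R * x))"
    using Suc by simp
  finally show ?case .
qed

text \<open>The stopped integrand at step \<open>n\<close> dominates the indicator of ruin by that
  step.\<close>

lemma maximal_bound:
  assumes "0 \<le> x"
  shows "prob {\<omega> \<in> space M. \<exists>k\<le>n. walk k \<omega> < 0} \<le> exp (- R * x)"
proof -
  have "emeasure M {\<omega> \<in> space M. \<exists>k\<le>n. walk k \<omega> < 0} =
      (\<integral>\<^sup>+\<omega>. indicator {\<omega> \<in> space M. \<exists>k\<le>n. walk k \<omega> < 0} \<omega> \<partial>M)"
    by (rule nn_integral_indicator[symmetric]) measurable
  also have "\<dots> \<le> (\<integral>\<^sup>+\<omega>. of_bool (\<not> solvent n \<omega>) + ennreal (exp (- R * walk n \<omega>)) * of_bool (solvent n \<omega>) \<partial>M)"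
    by (rule nn_integral_mono) (auto simp: indicator_def not_le)
  also have "\<dots> \<le> ennreal (exp (- R * x))"
    using nn_integral_stopped_le[OF assms, of n] by simp
  finally show ?thesis
    by (simp add: emeasure_eq_measure)
qed

end


section \<open>Poisson generating function, and Stieltjes integrals as expectations\<close>

text \<open>The sum is the exponential series at \<open>r * m\<close>, scaled by
  \<open>exp (- r)\<close>.\<close>

lemma nn_integral_power_poisson_pmf:
  assumes r: "0 < r" and m: "0 \<le> m"
  shows "(\<integral>\<^sup>+k. ennreal m ^ k \<partial>measure_pmf (poisson_pmf r)) = ennreal (exp (r * (m - 1)))"
proof -
  have "(\<lambda>k. (r * m) ^ k /\<^sub>R fact k * exp (- r)) sums (exp (r * m) * exp (- r))"
    by (intro sums_mult2 exp_converges)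
  then have sums: "(\<lambda>k. r ^ k / fact k * exp (- r) * m ^ k) sums exp (r * (m - 1))"
    by (simp add: power_mult_distrib divide_inverse mult_ac exp_diff exp_minus right_diff_distrib)
  have "(\<integral>\<^sup>+k. ennreal m ^ k \<partial>measure_pmf (poisson_pmf r)) =
      (\<Sum>k. ennreal (pmf (poisson_pmf r) k) * ennreal m ^ k)"
    by (simp only: nn_integral_measure_pmf nn_integral_count_space_nat)
  also have "\<dots> = (\<Sum>k. ennreal (r ^ k / fact k * exp (- r) * m ^ k))"
    using r m by (intro arg_cong[where f=suminf] ext)
      (simp add: ennreal_mult[symmetric] ennreal_power)
  also have "\<dots> = ennreal (exp (r * (m - 1)))"
    using r m by (intro suminf_ennreal_eq[OF _ sums]) simp
  finally show ?thesis .
qed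

context prob_space
begin

text \<open>A distribution function determines its law. Hence the integrals in the adjustment
  equation are expectations.\<close>

lemma interval_measure_eq_distr:
  assumes X [measurable]: "random_variable borel X"
    and F: "\<And>y. prob {\<omega> \<in> space M. X \<omega> \<le> y} = F y"
  shows "interval_measure F = distr M borel X"
proof -
  interpret D: real_distribution "distr M borel X"
    by (rule real_distribution_distr) simp
  have F_eq: "F = cdf (distr M borel X)"
    by (auto simp: cdf_def measure_distr F[symmetric] intro!: ext arg_cong[where f=prob])
  have mono: "F y \<le> F z" if "y \<le> z" for y z
    unfolding F_eq using that by (rule D.cdf_nondecreasing)
  have rc: "continuous (at_right y) F" for y
    unfolding F_eq by (rule D.cdf_is_right_cont)
  have bot: "(F \<longlongrightarrow> 0) at_bot" and top: "(F \<longlongrightarrow> 1) at_top"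
    unfolding F_eq by (rule D.cdf_lim_at_bot, rule D.cdf_lim_at_top_prob)
  show ?thesis
  proof (rule cdf_unique)
    show "real_distribution (interval_measure F)"
      using mono rc bot top by (rule real_distribution_interval_measure)
    show "cdf (interval_measure F) = cdf (distr M borel X)"
      using cdf_interval_measure[OF mono rc bot] F_eq by simp
  qed (rule D.real_distribution_axioms)
qed

text \<open>Restricting to \<open>{0..}\<close> loses nothing because \<open>X\<close> is almost
  surely nonnegative, and the closed end keeps an atom at \<open>0\<close>. Assumption
  \<open>int\<close> guarantees that the Bochner integral is the true value and not the default
  \<open>0\<close>.\<close>

lemma nn_integral_exp_interval_measure:
  assumes X [measurable]: "random_variable borel X" and nonneg: "AE \<omega> in M. 0 \<le> X \<omega>"
    and F: "\<And>y. prob {\<omega> \<in> space M. X \<omega> \<le> y} = F y"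
    and int: "set_integrable (interval_measure F) {0..} (\<lambda>y. exp (k * y))"
  shows "(\<integral>\<^sup>+\<omega>. ennreal (exp (k * X \<omega>)) \<partial>M) = ennreal (LINT y:{0..}|interval_measure F. exp (k * y))"
proof -
  have "ennreal (LINT y:{0..}|interval_measure F. exp (k * y)) =
      (\<integral>\<^sup>+y. ennreal (indicator {0..} y *\<^sub>R exp (k * y)) \<partial>interval_measure F)"
    using int unfolding set_integrable_def set_lebesgue_integral_def
    by (subst nn_integral_eq_integral) auto
  also have "\<dots> = (\<integral>\<^sup>+\<omega>. ennreal (indicator {0..} (X \<omega>) *\<^sub>R exp (k * X \<omega>)) \<partial>M)"
    unfolding interval_measure_eq_distr[OF X F] by (subst nn_integral_distr) auto
  also have "\<dots> = (\<integral>\<^sup>+\<omega>. ennreal (exp (k * X \<omega>)) \<partial>M)"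
    using nonneg by (intro nn_integral_cong_AE) (auto elim!: eventually_mono)
  finally show ?thesis ..
qed

text \<open>For \<open>k \<le> 0\<close> the integrand is bounded by \<open>1\<close> on
  \<open>{0..}\<close>. This serves the transform of the additional funds, with
  \<open>k = - R\<close>.\<close>

lemma set_integrable_exp_interval_measure:
  assumes X: "random_variable borel X"
    and F: "\<And>y. prob {\<omega> \<in> space M. X \<omega> \<le> y} = F y" and k: "k \<le> 0"
  shows "set_integrable (interval_measure F) {0..} (\<lambda>y. exp (k * y))"
proof -
  interpret D: prob_space "distr M borel X"
    using X by (rule prob_space_distr)
  show ?thesis
    unfolding set_integrable_def interval_measure_eq_distr[OF X F] using k
    by (intro D.integrable_const_bound[where B=1])
      (auto simp: indicator_def mult_nonpos_nonneg)
qed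

end

section \<open>The surplus observed on a grid of times\<close>

context risk_model
begin

lemma claim_measurable [measurable]: "1 \<le> i \<Longrightarrow> random_variable borel (\<xi> i)"
  and fund_measurable [measurable]: "1 \<le> i \<Longrightarrow> random_variable borel (\<eta> i)"
  using \<xi>_indep \<eta>_indep by (auto simp: indep_vars_def)

lemma surplus_measurable:
  assumes "0 \<le> t"
  shows "random_variable borel (surplus c \<xi> \<eta> N x t)"
proof -
  have "random_variable borel (\<lambda>\<omega>. \<Sum>i = 1..N t \<omega>. \<xi> i \<omega> - \<eta> i \<omega>)"
    by (rule measurable_compose_countable[OF _ N_measurable[OF assms]])
      (auto intro!: borel_measurable_sum borel_measurable_diff)
  then show ?thesis
    unfolding surplus_def[abs_def] by measurable
qed

text \<open>Mutual independence is assumed for the events generated by \<open>N\<close>. An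
  increment is a function of two values of \<open>N\<close>, so its events are among these, and
  independence carries over to increments.\<close>

lemma generated_events_increment:
  assumes "0 \<le> s" "0 \<le> t"
  shows "(\<lambda>\<omega>. real (N t \<omega> - N s \<omega>)) -` B \<inter> space M
    \<in> generated_events M (count_space UNIV) N {0..}"
proof -
  define G where "G = (\<Union>r\<in>{0..}. {N r -` A \<inter> space M | A. A \<in> sets (count_space (UNIV :: nat set))})"
  have G: "G \<subseteq> Pow (space M)"
    by (auto simp: G_def)
  have [measurable]: "N r \<in> measurable (sigma (space M) G) (count_space UNIV)" if "0 \<le> r" for r
  proof (rule measurableI)
    fix A :: "nat set"
    show "N r -` A \<inter> space (sigma (space M) G) \<in> sets (sigma (space M) G)"
      using that G by (auto simp: sets_measure_of space_measure_of G_def intro!: sigma_sets.Basic)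
  qed auto
  have "(\<lambda>\<omega>. N t \<omega> - N s \<omega>) \<in> measurable (sigma (space M) G) (count_space UNIV)"
    using assms by measurable
  then have "(\<lambda>\<omega>. N t \<omega> - N s \<omega>) -` (real -` B) \<inter> space (sigma (space M) G) \<in> sets (sigma (space M) G)"
    by (rule measurable_sets) simp
  moreover have "(\<lambda>\<omega>. N t \<omega> - N s \<omega>) -` (real -` B) = (\<lambda>\<omega>. real (N t \<omega> - N s \<omega>)) -` B"
    by auto
  ultimately show ?thesis
    using G unfolding generated_events_def G_def[symmetric] by simp
qed

text \<open>The families of claims, funds and increments are tagged \<open>0\<close>, \<open>1\<close> and \<open>2\<close>.\<close>

lemma indep_claims_funds_increments:
  assumes h: "0 < h"
  defines "W \<equiv> \<lambda>(k::nat, i). if k = 0 then \<xi> i else if k = 1 then \<eta> i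
      else (\<lambda>\<omega>. real (N (real (Suc i) * h) \<omega> - N (real i * h) \<omega>))"
  shows "indep_vars (\<lambda>_. borel) W (Sigma {..<3} (\<lambda>k. if k = 2 then {..<n} else {1..}))"
proof (rule indep_vars_Sigma)
  have "indep_vars (\<lambda>_. count_space UNIV) (\<lambda>i \<omega>. N (real (Suc i) * h) \<omega> - N (real i * h) \<omega>) {..<n}"
    using h by (intro N_indep_increments) (auto simp: strict_mono_on_def)
  then have "indep_vars (\<lambda>_. borel) (\<lambda>i \<omega>. real (N (real (Suc i) * h) \<omega> - N (real i * h) \<omega>)) {..<n}"
    by (rule indep_vars_compose2) simp
  then show inner: "indep_vars (\<lambda>_. borel) (\<lambda>i. W (k, i)) (if k = 2 then {..<n} else {1..})"
    if "k \<in> {..<3}" for k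
    using \<xi>_indep \<eta>_indep that by (auto simp: W_def less_Suc_eq numeral_3_eq_3)
  show "random_variable borel (W (k, i))"
    if "k \<in> {..<3}" "i \<in> (if k = 2 then {..<n} else {1..})" for k i
    using inner[OF that(1)] that(2) by (simp add: indep_vars_def)
  show "indep_sets (\<lambda>k. sigma_sets (space M) (\<Union>i\<in>if k = 2 then {..<n} else {1..}.
      {W (k, i) -` A \<inter> space M | A. A \<in> sets borel})) {..<3}"
  \<comment> \<open>Independence passes to smaller families of events. For claims and funds the
    families coincide; the increments generate a part of the events of \<open>N\<close>.\<close>
  proof (rule indep_sets_mono_sets[OF mutually_independent])
    fix k :: nat assume "k \<in> {..<3}"
    then consider "k = 0" | "k = 1" | "k = 2" by fastforce
    then show "sigma_sets (space M) (\<Union>i\<in>if k = 2 then {..<n} else {1..}.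
      {W (k, i) -` A \<inter> space M | A. A \<in> sets borel}) \<subseteq>
      [generated_events M borel \<xi> {1..}, generated_events M borel \<eta> {1..},
       generated_events M (count_space UNIV) N {0..}] ! k"
    proof cases
      case 3
      have "sigma_sets (space M) (\<Union>i<n. {W (2, i) -` A \<inter> space M | A. A \<in> sets borel})
        \<subseteq> generated_events M (count_space UNIV) N {0..}"
      proof (unfold generated_events_def, rule sigma_sets_mono, fold generated_events_def, safe)
        fix i and A :: "real set"
        show "W (2, i) -` A \<inter> space M \<in> generated_events M (count_space UNIV) N {0..}"
          using generated_events_increment[of "real i * h" "real (Suc i) * h" A] h
          by (simp add: W_def)
      qed
      then show ?thesis using 3 by simp
    qed (simp_all add: generated_events_def W_def)
  qed
qed

lemma nn_integral_increment:
  assumes s: "0 \<le> s" "s < t" and m: "0 \<le> m"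
  shows "(\<integral>\<^sup>+\<omega>. ennreal m ^ (N t \<omega> - N s \<omega>) \<partial>M) = ennreal (exp (rate * (t - s) * (m - 1)))"
proof -
  have [measurable]: "random_variable (count_space UNIV) (N s)" "random_variable (count_space UNIV) (N t)"
    using s by (auto intro: N_measurable)
  have "(\<integral>\<^sup>+\<omega>. ennreal m ^ (N t \<omega> - N s \<omega>) \<partial>M) =
      (\<integral>\<^sup>+k. ennreal m ^ k \<partial>distr M (count_space UNIV) (\<lambda>\<omega>. N t \<omega> - N s \<omega>))"
    by (rule nn_integral_distr[symmetric]) measurable
  also have "\<dots> = ennreal (exp (rate * (t - s) * (m - 1)))"
    unfolding N_increments[OF s] using rate_pos s m by (intro nn_integral_power_poisson_pmf) auto
  finally show ?thesis .
qed

text \<open>Sampling at multiples of \<open>h\<close> gives a \<open>compound_walk\<close> with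
  premium \<open>c * h\<close> per step and \<open>m = m1 * m2\<close>. The bound depends on neither
  \<open>h\<close> nor \<open>n\<close>, which later allows the grid to be refined and
  extended.\<close>

lemma ruin_on_grid_bound:
  assumes R: "0 < R" and x: "0 \<le> x" and h: "0 < h"
    and claim_exp: "\<And>i. 1 \<le> i \<Longrightarrow> (\<integral>\<^sup>+\<omega>. ennreal (exp (R * \<xi> i \<omega>)) \<partial>M) = ennreal m1" and m1: "0 \<le> m1"
    and fund_exp: "\<And>i. 1 \<le> i \<Longrightarrow> (\<integral>\<^sup>+\<omega>. ennreal (exp (- R * \<eta> i \<omega>)) \<partial>M) = ennreal m2" and m2: "0 \<le> m2"
    and adj: "rate * (m1 * m2 - 1) = c * R"
  shows "prob {\<omega> \<in> space M. \<exists>k\<le>n. surplus c \<xi> \<eta> N x (real k * h) \<omega> < 0} \<le> exp (- R * x)"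
proof -
  \<comment> \<open>The shift by \<open>Suc\<close> reconciles the model, which numbers claims from
    \<open>1\<close>, with the walk, which numbers them from \<open>0\<close>.\<close>
  define Z where "Z i \<omega> = \<xi> (Suc i) \<omega> - \<eta> (Suc i) \<omega>" for i \<omega>
  define D where "D i \<omega> = N (real (Suc i) * h) \<omega> - N (real i * h) \<omega>" for i \<omega>
  define W where "W = (\<lambda>(k::nat, i). if k = 0 then \<xi> i else if k = 1 then \<eta> i
      else (\<lambda>\<omega>. real (N (real (Suc i) * h) \<omega> - N (real i * h) \<omega>)))"
  \<comment> \<open>\<open>K b\<close> holds the coordinates of \<open>W\<close> that enter the
    \<open>b\<close>-th variable of the walk: a claim with its fund, or a single increment. These
    blocks are disjoint, so the variables \<open>Y b\<close> computed from them are
    independent.\<close>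
  define K where "K = case_sum (\<lambda>i. {(0::nat, Suc i), (1, Suc i)}) (\<lambda>j. {(2, j)})"
  define I where "I = Sigma {..<3::nat} (\<lambda>k. if k = 2 then {..<n} else {1..})"
  define L :: "(nat + nat) set" where "L = range Inl \<union> Inr ` {..<n}"
  define Y where "Y b w = (case b of Inl i \<Rightarrow> w (0, Suc i) - w (1, Suc i) | Inr j \<Rightarrow> w (2, j))"
    for b :: "nat + nat" and w :: "nat \<times> nat \<Rightarrow> real"
  have W: "indep_vars (\<lambda>_. borel) W I"
    unfolding W_def I_def by (rule indep_claims_funds_increments[OF h])
  have "indep_vars (\<lambda>b. PiM (K b) (\<lambda>_. borel)) (\<lambda>b \<omega>. \<lambda>p\<in>K b. W p \<omega>) L"
    by (rule indep_vars_restrict[OF W])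
      (auto simp: K_def I_def L_def disjoint_family_on_def split: sum.split)
  then have "indep_vars (\<lambda>_. borel) (\<lambda>b \<omega>. Y b (\<lambda>p\<in>K b. W p \<omega>)) L"
  proof (rule indep_vars_compose2)
    fix b assume "b \<in> L"
    show "Y b \<in> borel_measurable (PiM (K b) (\<lambda>_. borel))"
      unfolding Y_def[abs_def]
      by (cases b) (auto simp: K_def intro!: borel_measurable_diff measurable_component_singleton)
  qed
  moreover have "Y b (\<lambda>p\<in>K b. W p \<omega>) = case_sum Z (\<lambda>j \<omega>. real (D j \<omega>)) b \<omega>" for b \<omega>
    by (cases b) (auto simp: Y_def K_def W_def Z_def D_def)
  ultimately have indep: "indep_vars (\<lambda>_. borel) (case_sum Z (\<lambda>j \<omega>. real (D j \<omega>))) L"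
    by simp
  have Z_exp: "(\<integral>\<^sup>+\<omega>. ennreal (exp (R * Z i \<omega>)) \<partial>M) = ennreal (m1 * m2)" for i
  proof -
    let ?J = "{(0::nat, Suc i), (1, Suc i)}"
    have "indep_vars (\<lambda>_. borel) W ?J"
      by (rule indep_vars_subset[OF W]) (auto simp: I_def)
    then have "indep_vars (\<lambda>_. borel) (\<lambda>p \<omega>. ennreal (exp ((if fst p = 0 then R else - R) * W p \<omega>))) ?J"
      by (rule indep_vars_compose2) simp
    from indep_vars_nn_integral[OF _ this] show ?thesis
      using claim_exp[of "Suc i"] fund_exp[of "Suc i"] m1 m2
      by (simp add: W_def Z_def right_diff_distrib exp_diff exp_minus divide_inverse ennreal_mult)
  qed
  have D_exp: "(\<integral>\<^sup>+\<omega>. ennreal (m1 * m2) ^ D j \<omega> \<partial>M) = ennreal (exp (R * (c * h)))" for j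
  proof -
    \<comment> \<open>The adjustment equation enters here: the Poisson exponent for a step of length
      \<open>h\<close> becomes \<open>c * R * h\<close>.\<close>
    have "rate * (real (Suc j) * h - real j * h) * (m1 * m2 - 1) = rate * (m1 * m2 - 1) * h"
      by (simp add: algebra_simps)
    then show ?thesis
      unfolding D_def using h m1 m2 adj by (subst nn_integral_increment) (auto simp: mult_ac)
  qed
  have D_meas: "random_variable (count_space UNIV) (D j)" for j
  proof -
    have [measurable]: "random_variable (count_space UNIV) (N (real j * h))" for j
      using h by (intro N_measurable) simp
    show ?thesis unfolding D_def[abs_def] by measurable
  qed
  interpret walk: compound_walk M Z D n "\<lambda>_. c * h" R "m1 * m2" x
    using D_meas indep Z_exp D_exp R by unfold_locales (auto simp: L_def)
  \<comment> \<open>Monotone paths starting at \<open>0\<close> make the truncated differences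
    \<open>D\<close> telescope to \<open>N\<close>; both properties hold only almost surely.\<close>
  have "AE \<omega> in M. \<forall>k. surplus c \<xi> \<eta> N x (real k * h) \<omega> = walk.walk k \<omega>"
    using N_zero N_mono
  proof eventually_elim
    case (elim \<omega>)
    show ?case
    proof
      fix k
      have "N (real j * h) \<omega> \<le> N (real (Suc j) * h) \<omega>" for j
        using h by (intro mono_onD[OF elim(2)]) auto
      then have "walk.claims k \<omega> = N (real k * h) \<omega>"
        using elim(1) by (induction k) (auto simp: walk.claims_def D_def)
      then show "surplus c \<xi> \<eta> N x (real k * h) \<omega> = walk.walk k \<omega>"
        by (simp add: surplus_def walk.walk_def Z_def sum.atLeast1_atMost_eq)
    qed
  qed
  then have "prob {\<omega> \<in> space M. \<exists>k\<le>n. surplus c \<xi> \<eta> N x (real k * h) \<omega> < 0}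
      \<le> prob {\<omega> \<in> space M. \<exists>k\<le>n. walk.walk k \<omega> < 0}"
    by (intro finite_measure_mono_AE) auto
  also have "\<dots> \<le> exp (- R * x)"
    using x by (rule walk.maximal_bound)
  finally show ?thesis .
qed

section \<open>From dyadic grids to continuous time\<close>

text \<open>Just after a time of negative surplus no claim arrives and the surplus varies
  continuously, so it stays negative on an interval, which any fine enough grid meets.\<close>

lemma AE_ruin_on_dyadic_grid:
  "AE \<omega> in M. (\<exists>t\<ge>0. surplus c \<xi> \<eta> N x t \<omega> < 0) \<longrightarrow>
    (\<exists>m k. k \<le> 4 ^ m \<and> surplus c \<xi> \<eta> N x (real k * (1 / 2 ^ m)) \<omega> < 0)"
  using N_right_continuous
proof (eventually_elim, safe)
  fix \<omega> t
  let ?X = "\<lambda>t. surplus c \<xi> \<eta> N x t \<omega>"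
  assume rc: "\<forall>t\<ge>0. continuous (at_right t) (\<lambda>s. N s \<omega>)" and t: "0 \<le> t" "?X t < 0"
  let ?S = "\<Sum>i = 1..N t \<omega>. \<xi> i \<omega> - \<eta> i \<omega>"
  have "((\<lambda>s. N s \<omega>) \<longlongrightarrow> N t \<omega>) (at_right t)"
    using rc t by (auto simp: continuous_within)
  then have "\<forall>\<^sub>F s in at_right t. N s \<omega> = N t \<omega>"
    by (simp add: tendsto_discrete)
  moreover have "\<forall>\<^sub>F s in at_right t. x + c * s - ?S < 0"
  proof (rule order_tendstoD(2))
    show "((\<lambda>s. x + c * s - ?S) \<longlongrightarrow> x + c * t - ?S) (at_right t)"
      by (intro tendsto_intros)
  qed (use t in \<open>simp add: surplus_def\<close>)
  ultimately have "\<forall>\<^sub>F s in at_right t. ?X s < 0"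
    by eventually_elim (simp add: surplus_def)
  then obtain b where b: "t < b" "\<And>s. t < s \<Longrightarrow> s < b \<Longrightarrow> ?X s < 0"
    by (auto simp: eventually_at_right[OF less_add_one])
  \<comment> \<open>The bound \<open>1 / (b - t)\<close> makes the mesh finer than the interval; the
    bound \<open>t + 1\<close> gives \<open>k \<le> (t + 1) * 2 ^ m \<le> 4 ^ m\<close>.\<close>
  obtain m where m: "max (t + 1) (1 / (b - t)) < 2 ^ m"
    using real_arch_pow[of 2 "max (t + 1) (1 / (b - t))"] by auto
  \<comment> \<open>This is the first grid index strictly after \<open>t\<close>.\<close>
  define k where "k = Suc (nat \<lfloor>t * 2 ^ m\<rfloor>)"
  have k: "t * 2 ^ m < real k" "real k \<le> t * 2 ^ m + 1"
    using t unfolding k_def by (auto simp: of_nat_nat) linarith+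
  have "t * 2 ^ m + 1 \<le> (t + 1) * 2 ^ m"
    by (simp add: distrib_right)
  with k(2) have "real k \<le> (t + 1) * 2 ^ m"
    by linarith
  also have "\<dots> \<le> 2 ^ m * 2 ^ m"
    using m by (intro mult_right_mono) auto
  also have "\<dots> = real (4 ^ m)"
    by (simp add: power_mult_distrib[symmetric])
  finally have "k \<le> 4 ^ m"
    by (simp only: of_nat_le_iff)
  moreover have "?X (real k * (1 / 2 ^ m)) < 0"
  proof (rule b(2))
    show "t < real k * (1 / 2 ^ m)"
      using k(1) by (simp add: field_simps)
    have "1 < (b - t) * 2 ^ m"
      using m b(1) by (simp add: field_simps)
    then have "real k < b * 2 ^ m"
      using k(2) by (simp add: algebra_simps)
    then show "real k * (1 / 2 ^ m) < b"
      by (simp add: field_simps)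
  qed
  ultimately show "\<exists>m k. k \<le> 4 ^ m \<and> ?X (real k * (1 / 2 ^ m)) < 0"
    by blast
qed

text \<open>The grids are nested and their horizons \<open>4 ^ m / 2 ^ m = 2 ^ m\<close> grow
  without bound. The ruin events on them therefore increase, and continuity from below passes the
  bound to their union.\<close>

lemma ruin_probability_le_grid:
  assumes bound: "\<And>n h. 0 < h \<Longrightarrow>
    prob {\<omega> \<in> space M. \<exists>k\<le>n. surplus c \<xi> \<eta> N x (real k * h) \<omega> < 0} \<le> p"
  shows "ruin_probability M c \<xi> \<eta> N x \<le> p"
proof -
  define A where "A m = {\<omega> \<in> space M. \<exists>k\<le>4 ^ m. surplus c \<xi> \<eta> N x (real k * (1 / 2 ^ m)) \<omega> < 0}"
    for m :: nat
  have A_meas: "range A \<subseteq> events"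
  proof safe
    fix m
    have [measurable]: "random_variable borel (surplus c \<xi> \<eta> N x (real k * (1 / 2 ^ m)))" for k
      by (rule surplus_measurable) simp
    show "A m \<in> events"
      unfolding A_def by measurable
  qed
  have "incseq A"
  proof (rule incseq_SucI, safe)
    fix m \<omega> assume "\<omega> \<in> A m"
    then obtain k where \<omega>: "\<omega> \<in> space M" and k: "k \<le> 4 ^ m"
      "surplus c \<xi> \<eta> N x (real k * (1 / 2 ^ m)) \<omega> < 0"
      by (auto simp: A_def)
    then show "\<omega> \<in> A (Suc m)"
      \<comment> \<open>The same time point has index \<open>2 * k\<close> on the next grid, where
        indices up to \<open>4 * 4 ^ m\<close> are allowed.\<close>
      by (auto simp: A_def intro!: exI[of _ "2 * k"])
  qed
  then have "(\<lambda>m. prob (A m)) \<longlonglongrightarrow> prob (\<Union>m. A m)"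
    by (rule finite_Lim_measure_incseq[OF A_meas])
  then have lim: "prob (\<Union>m. A m) \<le> p"
  proof (rule LIMSEQ_le_const2)
    show "\<exists>k. \<forall>m\<ge>k. prob (A m) \<le> p"
      unfolding A_def by (intro exI allI impI bound) simp
  qed
  have "ruin_probability M c \<xi> \<eta> N x \<le> prob (\<Union>m. A m)"
    unfolding ruin_probability_def ruin_time_finite_iff
  proof (rule finite_measure_mono_AE)
    show "AE \<omega> in M. \<omega> \<in> {\<omega> \<in> space M. \<exists>t\<ge>0. surplus c \<xi> \<eta> N x t \<omega> < 0} \<longrightarrow> \<omega> \<in> (\<Union>m. A m)"
      using AE_ruin_on_dyadic_grid by eventually_elim (auto simp: A_def)
  qed (use A_meas in auto)
  with lim show ?thesis
    by simp
qed

end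

theorem theorem2:
  fixes M :: "'a measure"
    and rate c R \<mu>1 \<mu>2 :: real
    and \<xi> \<eta> :: "nat \<Rightarrow> 'a \<Rightarrow> real"
    and F1 F2 :: "real \<Rightarrow> real"
    and N :: "real \<Rightarrow> 'a \<Rightarrow> nat"
  assumes model: "risk_model M rate N c \<xi> F1 \<mu>1 \<eta> F2 \<mu>2"
    and R_pos: "0 < R"
    and finite_exp_moment: "set_integrable (interval_measure F1) {0..} (\<lambda>y. exp (R * y))"
    and adjustment:
      "rate * ((LINT y:{0..}|interval_measure F1. exp (R * y)) *
               (LINT y:{0..}|interval_measure F2. exp (- R * y)) - 1) = c * R"
  shows "\<forall>x\<ge>0. ruin_probability M c \<xi> \<eta> N x \<le> exp (- R * x)"
proof (intro allI impI)
  fix x :: real assume x: "0 \<le> x"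
  interpret risk_model M rate N c \<xi> F1 \<mu>1 \<eta> F2 \<mu>2 by (rule model)
  show "ruin_probability M c \<xi> \<eta> N x \<le> exp (- R * x)"
  proof (rule ruin_probability_le_grid)
    fix n :: nat and h :: real assume h: "0 < h"
    show "prob {\<omega> \<in> space M. \<exists>k\<le>n. surplus c \<xi> \<eta> N x (real k * h) \<omega> < 0} \<le> exp (- R * x)"
    proof (rule ruin_on_grid_bound[OF R_pos x h _ _ _ _ adjustment])
      fix i :: nat assume i: "1 \<le> i"
      show "(\<integral>\<^sup>+\<omega>. ennreal (exp (R * \<xi> i \<omega>)) \<partial>M) =
          ennreal (LINT y:{0..}|interval_measure F1. exp (R * y))"
        using i \<xi>_nonneg \<xi>_cdf finite_exp_moment
        by (intro nn_integral_exp_interval_measure claim_measurable)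
      have "set_integrable (interval_measure F2) {0..} (\<lambda>y. exp (- R * y))"
        using R_pos by (intro set_integrable_exp_interval_measure[OF fund_measurable[OF i] \<eta>_cdf[OF i]]) simp
      then show "(\<integral>\<^sup>+\<omega>. ennreal (exp (- R * \<eta> i \<omega>)) \<partial>M) =
          ennreal (LINT y:{0..}|interval_measure F2. exp (- R * y))"
        using i \<eta>_nonneg \<eta>_cdf
        by (intro nn_integral_exp_interval_measure fund_measurable)
    \<comment> \<open>What remains is that both exponential transforms are nonnegative.\<close>
    qed (auto simp: set_lebesgue_integral_def intro!: Bochner_Integration.integral_nonneg)
  qed
qed

end
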